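(* (1) There are acyclic HDA which cannot be sculpted. (2) There is an HDA which cannot be sculpted, but whose unfolding can be sculpted. (3) There is an HDA which can be sculpted, but whose unfolding cannot be sculpted. (4) There is an HDA which can be sculpted and whose unfolding can be sculpted. (5) There is an HDA which cannot be sculpted and whose unfolding cannot be sculpted.
   Context: Precubical sets: families of disjoint sets $Q_n$ with face maps $s_k,t_k:Q_n\to Q_{n-1}$ ($k=1,\dots,n$) satisfying $\alpha_k\beta_\ell=\beta_{\ell-1}\alpha_k$ for $\alpha,\beta\in\{s,t\}$, $k<\ell$. An HDA is a precubical set with an initial cell $I\in Q_0$ (finite unless stated otherwise); HDA morphisms are face-map-commuting maps preserving the initial cell; an embedding is an injective HDA morphism. The bulk $B^d$ has $n$-cells the tuples in $\{0,\ast,1\}^d$ with exactly $n$ entries $\ast$, $s_k$ (resp. $t_k$) replacing the $k$-th $\ast$ by $0$ (resp. $1$), initial cell $(0,\dots,0)$. An HDA can be sculpted if it admits an HDA embedding into some bulk $B^d$. A step is $q'\xrightarrow{s_i}q$ with $s_iq=q'$ or $q\xrightarrow{t_i}q'$ with $t_iq=q'$; paths are sequences of consecutive steps, rooted if starting at $I$. HDA are assumed connected (each cell is the end of a rooted path). $Q$ is acyclic if there are no two different cells each reachable by a path from the other. Two paths are elementarily homotopic if one is obtained from the other by replacing, for some $i<j$, a segment $\xrightarrow{s_i}q\xrightarrow{s_j}$ by $\xrightarrow{s_{j-1}}q'\xrightarrow{s_i}$, or $\xrightarrow{t_j}q\xrightarrow{t_i}$ by $\xrightarrow{t_i}q'\xrightarrow{t_{j-1}}$,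 or $\xrightarrow{s_i}q\xrightarrow{t_j}$ by $\xrightarrow{t_{j-1}}q'\xrightarrow{s_i}$, or $\xrightarrow{s_j}q\xrightarrow{t_i}$ by $\xrightarrow{t_i}q'\xrightarrow{s_{j-1}}$ (keeping endpoints); homotopy is the equivalence generated. The unfolding of an HDA $Q$ is the (possibly infinite) HDA whose $n$-cells are pairs $(q,[\pi])$ with $q\in Q_n$ and $[\pi]$ a homotopy class of rooted paths ending at $q$, with $t_i(q,[\pi])=(t_iq,[\pi\xrightarrow{t_i}t_iq])$, $s_i(q,[\pi])=(s_iq,[\pi'])$ where $\pi'$ is a rooted path ending at $s_iq$ with $\pi'\xrightarrow{s_i}q$ homotopic to $\pi$, and initial cell $(I,[I])$. *)

theory Defs
  imports Main
begin

text \<open>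
  Face maps are indexed from 1, and the two families \<open>s\<close>, \<open>t\<close> are merged into one,
  selected by a \<open>side\<close>.  As the sets of \<open>n\<close>-cells are disjoint, the dimension is not an
  argument of the face maps; their values outside \<open>k = 1, \<dots>, n\<close> are irrelevant.
\<close>

datatype side = Src | Tgt

record 'a precubical =
  cells :: "nat \<Rightarrow> 'a set"
  face :: "side \<Rightarrow> nat \<Rightarrow> 'a \<Rightarrow> 'a"

record 'a hda = "'a precubical" +
  init :: 'a

abbreviation all_cells :: "('a, 'm) precubical_scheme \<Rightarrow> 'a set" where
  "all_cells Q \<equiv> \<Union>n. cells Q n"

locale precubical_set =
  fixes Q :: "('a, 'm) precubical_scheme"
  assumes cells_disjoint: "m \<noteq> n \<Longrightarrow> cells Q m \<inter> cells Q n = {}"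
    and face_closed: "\<lbrakk>q \<in> cells Q n; 1 \<le> k; k \<le> n\<rbrakk> \<Longrightarrow> face Q a k q \<in> cells Q (n - 1)"
    and face_face: "\<lbrakk>q \<in> cells Q n; 1 \<le> k; k < l; l \<le> n\<rbrakk> \<Longrightarrow>
      face Q a k (face Q b l q) = face Q b (l - 1) (face Q a k q)"


text \<open>
  A path is its start cell followed by a list of steps, each recorded with its label
  (\<open>s\<^sub>i\<close> or \<open>t\<^sub>i\<close>) and the cell it leads to.
\<close>

type_synonym 'a path = "'a \<times> (side \<times> nat \<times> 'a) list"

fun is_step :: "('a, 'm) precubical_scheme \<Rightarrow> 'a \<Rightarrow> side \<times> nat \<times> 'a \<Rightarrow> bool" where
  "is_step Q p (Src, i, q) \<longleftrightarrow> (\<exists>n. q \<in> cells Q n \<and> 1 \<le> i \<and> i \<le> n \<and> face Q Src i q = p)"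
| "is_step Q p (Tgt, i, q) \<longleftrightarrow> (\<exists>n. p \<in> cells Q n \<and> 1 \<le> i \<and> i \<le> n \<and> face Q Tgt i p = q)"

fun are_steps :: "('a, 'm) precubical_scheme \<Rightarrow> 'a \<Rightarrow> (side \<times> nat \<times> 'a) list \<Rightarrow> bool" where
  "are_steps Q p [] \<longleftrightarrow> True"
| "are_steps Q p ((a, i, q) # xs) \<longleftrightarrow> is_step Q p (a, i, q) \<and> are_steps Q q xs"

definition is_path :: "('a, 'm) precubical_scheme \<Rightarrow> 'a path \<Rightarrow> bool" where
  "is_path Q \<pi> \<longleftrightarrow> fst \<pi> \<in> all_cells Q \<and> are_steps Q (fst \<pi>) (snd \<pi>)"

definition path_end :: "'a path \<Rightarrow> 'a" where
  "path_end \<pi> = (if snd \<pi> = [] then fst \<pi> else snd (snd (last (snd \<pi>))))"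

definition path_snoc :: "'a path \<Rightarrow> side \<times> nat \<times> 'a \<Rightarrow> 'a path" where
  "path_snoc \<pi> x = (fst \<pi>, snd \<pi> @ [x])"

definition reachable :: "('a, 'm) precubical_scheme \<Rightarrow> 'a \<Rightarrow> 'a \<Rightarrow> bool" where
  "reachable Q p q \<longleftrightarrow> (\<exists>\<pi>. is_path Q \<pi> \<and> fst \<pi> = p \<and> path_end \<pi> = q)"

definition acyclic_hda :: "'a hda \<Rightarrow> bool" where
  "acyclic_hda Q \<longleftrightarrow> \<not> (\<exists>p q. p \<noteq> q \<and> reachable Q p q \<and> reachable Q q p)"

definition rooted_path :: "'a hda \<Rightarrow> 'a path \<Rightarrow> bool" where
  "rooted_path Q \<pi> \<longleftrightarrow> is_path Q \<pi> \<and> fst \<pi> = init Q"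

locale hd_automaton = precubical_set Q for Q :: "'a hda" +
  assumes init_cell: "init Q \<in> cells Q 0"
    and connected: "q \<in> all_cells Q \<Longrightarrow> \<exists>\<pi>. rooted_path Q \<pi> \<and> path_end \<pi> = q"

locale finite_hd_automaton = hd_automaton +
  assumes finite_cells: "finite (all_cells Q)"


definition hda_morphism :: "('a \<Rightarrow> 'b) \<Rightarrow> 'a hda \<Rightarrow> 'b hda \<Rightarrow> bool" where
  "hda_morphism f P Q \<longleftrightarrow>
     (\<forall>n. \<forall>q \<in> cells P n. f q \<in> cells Q n) \<and>
     (\<forall>n. \<forall>q \<in> cells P n. \<forall>a. \<forall>k \<in> {1..n}. f (face P a k q) = face Q a k (f q)) \<and>
     f (init P) = init Q"

definition hda_embedding :: "('a \<Rightarrow> 'b) \<Rightarrow> 'a hda \<Rightarrow> 'b hda \<Rightarrow> bool" where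
  "hda_embedding f P Q \<longleftrightarrow> hda_morphism f P Q \<and> inj_on f (all_cells P)"


datatype coord = Zero | Star | One

fun side_coord :: "side \<Rightarrow> coord" where
  "side_coord Src = Zero"
| "side_coord Tgt = One"

definition star_positions :: "coord list \<Rightarrow> nat list" where
  "star_positions x = filter (\<lambda>i. x ! i = Star) [0..<length x]"

definition bulk :: "nat \<Rightarrow> coord list hda" where
  "bulk d =
     \<lparr> cells = (\<lambda>n. {x. length x = d \<and> length (star_positions x) = n}),
       face = (\<lambda>a k x. x[star_positions x ! (k - 1) := side_coord a]),
       init = replicate d Zero \<rparr>"

definition sculptable :: "'a hda \<Rightarrow> bool" where
  "sculptable Q \<longleftrightarrow> (\<exists>d f. hda_embedding f Q (bulk d))"


inductive elem_homotopic :: "('a, 'm) precubical_scheme \<Rightarrow> 'a path \<Rightarrow> 'a path \<Rightarrow> bool"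
  for Q :: "('a, 'm) precubical_scheme" where
  ss: "\<lbrakk>i < j;
        is_path Q (p, xs @ [(Src, i, q), (Src, j, r)] @ ys);
        is_path Q (p, xs @ [(Src, j - 1, q'), (Src, i, r)] @ ys)\<rbrakk> \<Longrightarrow>
      elem_homotopic Q (p, xs @ [(Src, i, q), (Src, j, r)] @ ys)
                       (p, xs @ [(Src, j - 1, q'), (Src, i, r)] @ ys)"
| tt: "\<lbrakk>i < j;
        is_path Q (p, xs @ [(Tgt, j, q), (Tgt, i, r)] @ ys);
        is_path Q (p, xs @ [(Tgt, i, q'), (Tgt, j - 1, r)] @ ys)\<rbrakk> \<Longrightarrow>
      elem_homotopic Q (p, xs @ [(Tgt, j, q), (Tgt, i, r)] @ ys)
                       (p, xs @ [(Tgt, i, q'), (Tgt, j - 1, r)] @ ys)"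
| st_less: "\<lbrakk>i < j;
        is_path Q (p, xs @ [(Src, i, q), (Tgt, j, r)] @ ys);
        is_path Q (p, xs @ [(Tgt, j - 1, q'), (Src, i, r)] @ ys)\<rbrakk> \<Longrightarrow>
      elem_homotopic Q (p, xs @ [(Src, i, q), (Tgt, j, r)] @ ys)
                       (p, xs @ [(Tgt, j - 1, q'), (Src, i, r)] @ ys)"
| st_greater: "\<lbrakk>i < j;
        is_path Q (p, xs @ [(Src, j, q), (Tgt, i, r)] @ ys);
        is_path Q (p, xs @ [(Tgt, i, q'), (Src, j - 1, r)] @ ys)\<rbrakk> \<Longrightarrow>
      elem_homotopic Q (p, xs @ [(Src, j, q), (Tgt, i, r)] @ ys)
                       (p, xs @ [(Tgt, i, q'), (Src, j - 1, r)] @ ys)"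

definition homotopic :: "('a, 'm) precubical_scheme \<Rightarrow> 'a path \<Rightarrow> 'a path \<Rightarrow> bool" where
  "homotopic Q = equivclp (elem_homotopic Q)"

definition homotopy_class :: "('a, 'm) precubical_scheme \<Rightarrow> 'a path \<Rightarrow> 'a path set" where
  "homotopy_class Q \<pi> = {\<rho>. homotopic Q \<pi> \<rho>}"


text \<open>
  For an HDA, a cell \<open>(q, C)\<close> of the unfolding and an index in range, the paths chosen below
  exist and the resulting class does not depend on the choice.
\<close>

fun unfolding_face :: "'a hda \<Rightarrow> side \<Rightarrow> nat \<Rightarrow> 'a \<times> 'a path set \<Rightarrow> 'a \<times> 'a path set" where
  "unfolding_face Q Tgt i (q, C) =
     (let q' = face Q Tgt i q; \<pi> = (SOME \<pi>. \<pi> \<in> C)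
      in (q', homotopy_class Q (path_snoc \<pi> (Tgt, i, q'))))"
| "unfolding_face Q Src i (q, C) =
     (let q' = face Q Src i q;
          \<pi>' = (SOME \<pi>'. rooted_path Q \<pi>' \<and> path_end \<pi>' = q' \<and> path_snoc \<pi>' (Src, i, q) \<in> C)
      in (q', homotopy_class Q \<pi>'))"

definition hda_unfolding :: "'a hda \<Rightarrow> ('a \<times> 'a path set) hda" where
  "hda_unfolding Q =
     \<lparr> cells = (\<lambda>n. {(q, homotopy_class Q \<pi>) | q \<pi>.
                        q \<in> cells Q n \<and> rooted_path Q \<pi> \<and> path_end \<pi> = q}),
       face = unfolding_face Q,
       init = (init Q, homotopy_class Q (init Q, [])) \<rparr>"

end

theory Submission imports Defs begin

text \<open>
  Bulk edges are determined by their ends, so two edges from \<open>0\<close> to the same vertex cannot be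
  sculpted; unfolding separates their targets and leaves a tree.  A loop cannot be sculpted either,
  and it has an infinite unfolding, whereas bulks are finite.  A point serves for (4).

  For (3), remove the interior and the bottom \<open>**0\<close> from the three-dimensional cube.  The two ways
  around the missing bottom give two copies of the edge \<open>11*\<close> in the unfolding.  These copies have
  the same target, as the five remaining squares make all rooted paths through them to \<open>111\<close>
  homotopic, and both are parallel to \<open>00*\<close> through two squares each.  In a bulk, an edge is
  determined by its target and its direction, so an embedding would have to identify the copies.
\<close>

section \<open>Paths and homotopy\<close>

declare is_step.simps [simp del]

lemma are_steps_append:
  "are_steps Q p (xs @ ys) \<longleftrightarrow> are_steps Q p xs \<and> are_steps Q (path_end (p, xs)) ys"
  by (induction xs arbitrary: p) (auto simp: path_end_def)

lemma path_end_simps [simp]: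
  "path_end (p, []) = p" "path_end (p, xs @ [(a, i, q)]) = q"
  "path_end (p, (a, i, q) # xs) = path_end (q, xs)"
  by (auto simp: path_end_def)

lemma path_end_append: "path_end (p, xs @ ys) = path_end (path_end (p, xs), ys)"
  by (induction xs arbitrary: p) auto

lemma is_path_path_snoc:
  "is_path Q (path_snoc \<pi> x) \<longleftrightarrow> is_path Q \<pi> \<and> is_step Q (path_end \<pi>) x"
  by (cases \<pi>; cases x) (auto simp: is_path_def path_snoc_def are_steps_append)

lemma path_end_path_snoc [simp]: "path_end (path_snoc \<pi> (a, i, q)) = q"
  by (simp add: path_snoc_def)

lemma rooted_path_snoc:
  "rooted_path Q (path_snoc \<pi> x) \<longleftrightarrow> rooted_path Q \<pi> \<and> is_step Q (path_end \<pi>) x"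
  by (auto simp: rooted_path_def is_path_path_snoc) (auto simp: path_snoc_def)

text \<open>Peels a rooted path from its end, so that the paths to a cell can be computed from those
  to its predecessors.\<close>

lemma rooted_path_iff_last_step:
  "rooted_path Q (p, xs) \<and> path_end (p, xs) = q \<longleftrightarrow>
     p = init Q \<and> p \<in> all_cells Q \<and>
     (xs = [] \<and> q = p \<or>
      (\<exists>r a i ys. xs = ys @ [(a, i, q)] \<and> rooted_path Q (p, ys) \<and> path_end (p, ys) = r \<and>
         is_step Q r (a, i, q)))"
  by (cases xs rule: rev_cases)
    (auto simp: rooted_path_def is_path_def are_steps_append)

lemma elem_homotopic_is_path:
  "elem_homotopic Q \<pi> \<rho> \<Longrightarrow> is_path Q \<pi> \<and> is_path Q \<rho>"
  by (induction rule: elem_homotopic.induct) auto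

lemma elem_homotopic_endpoints:
  "elem_homotopic Q \<pi> \<rho> \<Longrightarrow> fst \<pi> = fst \<rho> \<and> path_end \<pi> = path_end \<rho>"
  by (induction rule: elem_homotopic.induct) (auto simp: path_end_append)

text \<open>Each rule replaces two consecutive steps and keeps the end of the second, so only the
  cell between them changes. This feeds the invariant that separates the two ways around the open
  box.\<close>

lemma elem_homotopic_differs_once:
  assumes "elem_homotopic Q \<pi> \<rho>"
  obtains m where "\<And>k. k \<noteq> m \<Longrightarrow> map (snd \<circ> snd) (snd \<pi>) ! k = map (snd \<circ> snd) (snd \<rho>) ! k"
proof -
  \<comment> \<open>This also covers \<open>k\<close> beyond the ends of the lists, where both sides
    reduce to the same lookup in \<open>vs\<close>.\<close>
  have "(us @ x # vs) ! k = (us @ y # vs) ! k" if "k \<noteq> length us" for us vs :: "'a list" and x y k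
    using that by (auto simp: nth_append nth_Cons')
  then have *: "\<exists>m. \<forall>k. k \<noteq> m \<longrightarrow> (us @ x # vs) ! k = (us @ y # vs) ! k" for us vs :: "'a list" and x y
    by blast
  from assms have "\<exists>m. \<forall>k. k \<noteq> m \<longrightarrow> map (snd \<circ> snd) (snd \<pi>) ! k = map (snd \<circ> snd) (snd \<rho>) ! k"
    by (induction rule: elem_homotopic.induct) (simp_all add: *)
  then show thesis using that by blast
qed

text \<open>The new step joins the right context \<open>ys\<close> of the rewritten segment.\<close>

lemma elem_homotopic_snoc:
  assumes "elem_homotopic Q \<pi> \<rho>" "is_step Q (path_end \<pi>) x"
  shows "elem_homotopic Q (path_snoc \<pi> x) (path_snoc \<rho> x)"
proof -
  have "is_path Q (path_snoc \<pi> x)" "is_path Q (path_snoc \<rho> x)"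
    using elem_homotopic_is_path[OF assms(1)] elem_homotopic_endpoints[OF assms(1)] assms(2)
    by (auto simp: is_path_path_snoc)
  with assms(1) show ?thesis
  proof (induction rule: elem_homotopic.induct)
    case (ss i j p xs q r ys q')
    then show ?case using elem_homotopic.ss[of i j Q p xs q r "ys @ [x]" q']
      by (simp add: path_snoc_def)
  next
    case (tt i j p xs q r ys q')
    then show ?case using elem_homotopic.tt[of i j Q p xs q r "ys @ [x]" q']
      by (simp add: path_snoc_def)
  next
    case (st_less i j p xs q r ys q')
    then show ?case using elem_homotopic.st_less[of i j Q p xs q r "ys @ [x]" q']
      by (simp add: path_snoc_def)
  next
    case (st_greater i j p xs q r ys q')
    then show ?case using elem_homotopic.st_greater[of i j Q p xs q r "ys @ [x]" q']
      by (simp add: path_snoc_def)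
  qed
qed

lemma homotopic_refl: "homotopic Q \<pi> \<pi>"
  by (simp add: homotopic_def)

lemma homotopic_sym: "homotopic Q \<pi> \<rho> \<Longrightarrow> homotopic Q \<rho> \<pi>"
  by (simp add: homotopic_def equivclp_sym)

lemma homotopic_trans [trans]: "homotopic Q \<pi> \<rho> \<Longrightarrow> homotopic Q \<rho> \<sigma> \<Longrightarrow> homotopic Q \<pi> \<sigma>"
  by (auto simp: homotopic_def intro: equivclp_trans)

lemma elem_homotopic_imp_homotopic:
  "elem_homotopic Q \<pi> \<rho> \<Longrightarrow> homotopic Q \<pi> \<rho>" "elem_homotopic Q \<pi> \<rho> \<Longrightarrow> homotopic Q \<rho> \<pi>"
  by (auto simp: homotopic_def intro: equivclp_sym)

text \<open>Preservation is required in both directions because homotopy is the symmetric closure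
  too.\<close>

lemma homotopic_invariant:
  assumes "homotopic Q \<pi> \<rho>" "P \<pi>"
    and "\<And>\<pi> \<rho>. P \<pi> \<Longrightarrow> elem_homotopic Q \<pi> \<rho> \<or> elem_homotopic Q \<rho> \<pi> \<Longrightarrow> P \<rho>"
  shows "P \<rho>"
  using assms(1) unfolding homotopic_def
  by (induction rule: equivclp_induct) (use assms(2,3) in blast)+

lemma homotopic_snoc:
  assumes "homotopic Q \<pi> \<rho>" "is_step Q (path_end \<pi>) x"
  shows "homotopic Q (path_snoc \<pi> x) (path_snoc \<rho> x)"
proof -
  \<comment> \<open>The equality of ends is carried along, since it allows \<open>x\<close> to be
    appended to every intermediate path.\<close>
  have "homotopic Q (path_snoc \<pi> x) (path_snoc \<rho> x) \<and> path_end \<rho> = path_end \<pi>"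
    using assms(1)
  proof (rule homotopic_invariant)
    fix \<sigma> \<tau>
    assume *: "homotopic Q (path_snoc \<pi> x) (path_snoc \<sigma> x) \<and> path_end \<sigma> = path_end \<pi>"
      and **: "elem_homotopic Q \<sigma> \<tau> \<or> elem_homotopic Q \<tau> \<sigma>"
    have end_eq: "path_end \<tau> = path_end \<pi>"
      using * ** by (auto dest: elem_homotopic_endpoints)
    have "homotopic Q (path_snoc \<sigma> x) (path_snoc \<tau> x)"
      using **
    proof
      assume "elem_homotopic Q \<sigma> \<tau>"
      then show ?thesis
        using elem_homotopic_snoc[of Q \<sigma> \<tau> x] elem_homotopic_imp_homotopic(1) * assms(2) by metis
    next
      assume "elem_homotopic Q \<tau> \<sigma>"
      then show ?thesis
        using elem_homotopic_snoc[of Q \<tau> \<sigma> x] elem_homotopic_imp_homotopic(2) end_eq assms(2) by metis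
    qed
    then show "homotopic Q (path_snoc \<pi> x) (path_snoc \<tau> x) \<and> path_end \<tau> = path_end \<pi>"
      using * end_eq homotopic_trans by blast
  qed (simp add: homotopic_refl)
  then show ?thesis ..
qed

lemma homotopy_class_eq_iff: "homotopy_class Q \<pi> = homotopy_class Q \<rho> \<longleftrightarrow> homotopic Q \<pi> \<rho>"
  unfolding homotopy_class_def using homotopic_refl homotopic_sym homotopic_trans by blast

lemma mem_homotopy_class_self: "\<pi> \<in> homotopy_class Q \<pi>"
  by (simp add: homotopy_class_def homotopic_refl)

text \<open>By \<open>homotopic_snoc\<close>, the representative picked by \<open>SOME\<close> may
  be exchanged for \<pi>.\<close>

lemma face_unfolding_Tgt:
  assumes "path_end \<pi> \<in> cells Q n" "1 \<le> i" "i \<le> n" "face Q Tgt i (path_end \<pi>) = q"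
  shows "face (hda_unfolding Q) Tgt i (path_end \<pi>, homotopy_class Q \<pi>)
           = (q, homotopy_class Q (path_snoc \<pi> (Tgt, i, q)))"
proof -
  have "(SOME \<rho>. \<rho> \<in> homotopy_class Q \<pi>) \<in> homotopy_class Q \<pi>"
    using mem_homotopy_class_self by (rule someI)
  then have "homotopic Q (path_snoc \<pi> (Tgt, i, q))
      (path_snoc (SOME \<rho>. \<rho> \<in> homotopy_class Q \<pi>) (Tgt, i, q))"
    using assms by (intro homotopic_snoc) (auto simp: homotopy_class_def is_step.simps)
  then show ?thesis
    using assms(4) by (simp add: hda_unfolding_def Let_def homotopy_class_eq_iff homotopic_sym)
qed

text \<open>Independence of the choice amounts to cancelling a final source step from a homotopy.
  The last assumption avoids this: every candidate path is already homotopic to \<pi>. It holds at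
  the few cells where source faces are computed below.\<close>

lemma face_unfolding_Src:
  assumes "rooted_path Q \<pi>" "face Q Src i q = path_end \<pi>"
    and "\<And>\<rho>. rooted_path Q \<rho> \<Longrightarrow> path_end \<rho> = path_end \<pi> \<Longrightarrow> homotopic Q \<pi> \<rho>"
  shows "face (hda_unfolding Q) Src i (q, homotopy_class Q (path_snoc \<pi> (Src, i, q)))
           = (path_end \<pi>, homotopy_class Q \<pi>)"
proof -
  let ?P = "\<lambda>\<rho>. rooted_path Q \<rho> \<and> path_end \<rho> = path_end \<pi> \<and>
    path_snoc \<rho> (Src, i, q) \<in> homotopy_class Q (path_snoc \<pi> (Src, i, q))"
  have "?P (SOME \<rho>. ?P \<rho>)"
    using assms(1) mem_homotopy_class_self by (intro someI[of ?P \<pi>]) blast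
  then have "homotopic Q \<pi> (SOME \<rho>. ?P \<rho>)"
    using assms(3) by blast
  then show ?thesis
    using assms(2) by (simp add: hda_unfolding_def Let_def homotopy_class_eq_iff homotopic_sym)
qed

text \<open>Every elementary homotopy involves a step of index \<open>j > i \<ge> 1\<close>, hence a
  cell of dimension at least 2.\<close>

lemma homotopy_class_one_dim:
  assumes "\<And>n q. q \<in> cells Q n \<Longrightarrow> n \<le> 1"
  shows "homotopy_class Q \<pi> = {\<pi>}"
proof -
  have no_step: "\<not> is_step Q p (a, j, q)" if "i < j" "1 \<le> i" for p a i j q
    using assms that by (cases a) (fastforce simp: is_step.simps)+
  have step_pos: "1 \<le> i" if "is_step Q p (a, i, q)" for p a i q
    using that by (cases a) (auto simp: is_step.simps)
  have "\<not> elem_homotopic Q \<sigma> \<tau>" for \<sigma> \<tau>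
  proof
    assume "elem_homotopic Q \<sigma> \<tau>"
    then show False
      by (induction rule: elem_homotopic.induct)
        (auto simp: is_path_def are_steps_append dest: no_step step_pos)
  qed
  then have "homotopic Q \<pi> \<rho> \<Longrightarrow> \<rho> = \<pi>" for \<rho>
    by (erule_tac homotopic_invariant) auto
  then show ?thesis
    by (auto simp: homotopy_class_def homotopic_refl)
qed

text \<open>A height has to be supplied because dimension does not serve: it drops along target
  steps.\<close>

lemma acyclic_hda_height:
  fixes h :: "'a \<Rightarrow> nat"
  assumes "\<And>p a i q. is_step Q p (a, i, q) \<Longrightarrow> h p < h q"
  shows "acyclic_hda Q"
proof -
  have "are_steps Q p xs \<Longrightarrow> path_end (p, xs) = p \<or> h p < h (path_end (p, xs))" for p xs
  proof (induction xs arbitrary: p)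
    case (Cons x xs)
    obtain a i q where "x = (a, i, q)"
      by (cases x)
    with Cons assms[of p a i q] show ?case
      by fastforce
  qed simp
  then have "reachable Q p q \<Longrightarrow> p = q \<or> h p < h q" for p q
    by (fastforce simp: reachable_def is_path_def)
  then show ?thesis
    unfolding acyclic_hda_def by (metis less_asym)
qed

section \<open>Bulks\<close>

lemma finite_bulk: "finite (all_cells (bulk d))"
proof -
  have "(UNIV :: coord set) = {Zero, Star, One}"
    using coord.exhaust by auto
  then have "finite (UNIV :: coord set)"
    by (metis finite.emptyI finite.insertI)
  then have "finite {x :: coord list. set x \<subseteq> UNIV \<and> length x = d}"
    by (rule finite_lists_length_eq)
  then show ?thesis
    by (rule rev_finite_subset) (auto simp: bulk_def)
qed

lemma sculptable_imp_finite:
  assumes "sculptable Q"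
  shows "finite (all_cells Q)"
proof -
  from assms obtain d f where f: "hda_embedding f Q (bulk d)"
    by (auto simp: sculptable_def)
  then have "f ` all_cells Q \<subseteq> all_cells (bulk d)"
    by (auto simp: hda_embedding_def hda_morphism_def)
  with f show ?thesis
    using finite_bulk finite_imageD finite_subset by (metis hda_embedding_def)
qed

lemma set_star_positions: "set (star_positions x) = {i. i < length x \<and> x ! i = Star}"
  by (auto simp: star_positions_def)

lemma side_coord_neq_Star [simp]: "side_coord a \<noteq> Star"
  by (cases a) auto

lemma star_positions_update:
  "c \<noteq> Star \<Longrightarrow> star_positions (x[i := c]) = filter (\<lambda>j. j \<noteq> i) (star_positions x)"
  unfolding star_positions_def filter_filter length_list_update
  by (cases "i < length x") (auto simp: nth_list_update intro!: filter_cong)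

lemma bulk_edge:
  assumes "x \<in> cells (bulk d) 1"
  obtains i where "star_positions x = [i]" "i < length x" "x ! i = Star" "length x = d"
    "\<And>a. face (bulk d) a 1 x = x[i := side_coord a]"
proof -
  from assms obtain i where "star_positions x = [i]"
    by (auto simp: bulk_def length_Suc_conv)
  then show thesis
    using assms that[of i] set_star_positions[of x] by (auto simp: bulk_def)
qed

text \<open>The ends differ at the position of the star, which excludes loops.\<close>

lemma bulk_edge_Src_neq_Tgt:
  assumes "x \<in> cells (bulk d) 1"
  shows "face (bulk d) Src 1 x \<noteq> face (bulk d) Tgt 1 x"
  using assms by (rule bulk_edge) (metis coord.distinct(3) nth_list_update_eq side_coord.simps)

text \<open>Putting the star back at its position in a face recovers the edge.\<close>

lemma bulk_edge_eqI:
  assumes "x \<in> cells (bulk d) 1" "y \<in> cells (bulk d) 1"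
    and "star_positions x = star_positions y" "face (bulk d) a 1 x = face (bulk d) a 1 y"
  shows "x = y"
proof -
  obtain i where i: "star_positions x = [i]" "x ! i = Star"
      "face (bulk d) a 1 x = x[i := side_coord a]"
    using assms(1) by (rule bulk_edge) blast
  obtain j where j: "star_positions y = [j]" "y ! j = Star"
      "face (bulk d) a 1 y = y[j := side_coord a]"
    using assms(2) by (rule bulk_edge) blast
  have "x = (x[i := side_coord a])[i := Star]" "y = (y[i := side_coord a])[i := Star]"
    using i j assms(3) by (metis list_update_id list_update_overwrite nth_list_update_eq list.inject)+
  then show ?thesis
    using i j assms(3,4) by (metis list.inject)
qed

text \<open>The direction is the only coordinate in which the two ends differ;
  \<open>bulk_edge_eqI\<close> does the rest.\<close>

lemma bulk_edge_determined_by_ends: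
  assumes x: "x \<in> cells (bulk d) 1" and y: "y \<in> cells (bulk d) 1"
    and eq: "\<And>a. face (bulk d) a 1 x = face (bulk d) a 1 y"
  shows "x = y"
proof -
  obtain i where i: "star_positions x = [i]" "i < d" "length x = d"
      "\<And>a. face (bulk d) a 1 x = x[i := side_coord a]"
    using x by (rule bulk_edge) auto
  obtain j where j: "star_positions y = [j]" "j < d" "length y = d"
      "\<And>a. face (bulk d) a 1 y = y[j := side_coord a]"
    using y by (rule bulk_edge) auto
  have "i = j"
  proof (rule ccontr)
    assume "i \<noteq> j"
    \<comment> \<open>Faces of \<open>y\<close> leave coordinate \<open>i\<close> alone, whereas
      those of \<open>x\<close> set it to \<open>Zero\<close> and to \<open>One\<close>.\<close>
    then have "y ! i = side_coord a" for a
      using eq[of a] i j by (metis nth_list_update_eq nth_list_update_neq)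
    from this[of Src] this[of Tgt] show False by simp
  qed
  then show ?thesis
    using bulk_edge_eqI[OF x y _ eq] i j by simp
qed

text \<open>Both faces remove the first star and differ only in the value written there. Thus
  opposite edges of a square have the same direction.\<close>

lemma bulk_square_star_positions:
  assumes "x \<in> cells (bulk d) 2"
  shows "star_positions (face (bulk d) Src 1 x) = star_positions (face (bulk d) Tgt 1 x)"
  by (simp add: bulk_def star_positions_update)

section \<open>Fans\<close>

text \<open>The common shape of the one-dimensional examples, for which the automaton axioms are
  checked once. Edges and vertices are both named by naturals, so instances must keep the edge
  numbers apart from \<open>0\<close> and the values of \<open>t\<close>.\<close>

definition fan :: "nat set \<Rightarrow> (nat \<Rightarrow> nat) \<Rightarrow> nat hda" where
  "fan E t =
     \<lparr> cells = (\<lambda>n. if n = 0 then insert 0 (t ` E) else if n = 1 then E else {}),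
       face = (\<lambda>a k e. case a of Src \<Rightarrow> 0 | Tgt \<Rightarrow> t e),
       init = 0 \<rparr>"

lemma cells_fan: "cells (fan E t) n = (if n = 0 then insert 0 (t ` E) else if n = 1 then E else {})"
  by (simp add: fan_def)

lemma face_fan [simp]: "face (fan E t) Src k e = 0" "face (fan E t) Tgt k e = t e"
  by (simp_all add: fan_def)

lemma init_fan [simp]: "init (fan E t) = 0"
  by (simp add: fan_def)

lemma all_cells_fan: "all_cells (fan E t) = insert 0 (t ` E) \<union> E"
proof
  show "insert 0 (t ` E) \<union> E \<subseteq> all_cells (fan E t)"
    using UN_upper[of 0 UNIV "cells (fan E t)"] UN_upper[of 1 UNIV "cells (fan E t)"]
    by (simp add: cells_fan)
qed (auto simp: cells_fan split: if_splits)

lemma is_step_fan: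
  "is_step (fan E t) p (a, i, q) \<longleftrightarrow>
     i = 1 \<and> (case a of Src \<Rightarrow> p = 0 \<and> q \<in> E | Tgt \<Rightarrow> p \<in> E \<and> q = t p)"
  by (cases a) (auto simp: is_step.simps cells_fan split: if_splits intro: exI[of _ "1::nat"])

lemma homotopy_class_fan: "homotopy_class (fan E t) \<pi> = {\<pi>}"
  by (rule homotopy_class_one_dim) (auto simp: cells_fan split: if_splits)

lemma finite_hd_automaton_fan:
  assumes "finite E" "E \<inter> insert 0 (t ` E) = {}"
  shows "finite_hd_automaton (fan E t)"
proof
  fix q assume "q \<in> all_cells (fan E t)"
  then consider "q = 0" | e where "e \<in> E" "q = t e" | "q \<in> E"
    by (auto simp: all_cells_fan)
  then show "\<exists>\<pi>. rooted_path (fan E t) \<pi> \<and> path_end \<pi> = q"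
  proof cases
    case 1
    then show ?thesis
      by (intro exI[of _ "(0, [])"]) (simp add: rooted_path_def is_path_def all_cells_fan)
  next
    case 2
    then show ?thesis
      by (intro exI[of _ "(0, [(Src, 1, e), (Tgt, 1, q)])"])
        (simp add: rooted_path_def is_path_def all_cells_fan is_step_fan)
  next
    case 3
    then show ?thesis
      by (intro exI[of _ "(0, [(Src, 1, q)])"])
        (simp add: rooted_path_def is_path_def all_cells_fan is_step_fan)
  qed
next
  show "finite (all_cells (fan E t))"
    using assms(1) by (simp add: all_cells_fan)
qed (use assms(2) in \<open>auto simp: cells_fan fan_def split: if_splits side.splits\<close>)

section \<open>The point: sculptable, with sculptable unfolding\<close>

abbreviation point :: "nat hda" where "point \<equiv> fan {} id"

lemma rooted_path_point: "rooted_path point \<pi> \<longleftrightarrow> \<pi> = (0, [])"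
proof -
  have "are_steps point 0 xs \<longleftrightarrow> xs = []" for xs
    by (cases xs) (auto simp: is_step_fan split: side.splits)
  then show ?thesis
    by (cases \<pi>) (auto simp: rooted_path_def is_path_def all_cells_fan)
qed

lemma sculptable_point: "sculptable point"
  unfolding sculptable_def hda_embedding_def hda_morphism_def
  \<comment> \<open>The only cell of \<open>bulk 0\<close> is the empty tuple.\<close>
  by (intro exI[of _ 0] exI[of _ "\<lambda>_. []"])
    (auto simp: cells_fan bulk_def star_positions_def all_cells_fan split: if_splits)

lemma sculptable_unfolding_point: "sculptable (hda_unfolding point)"
  unfolding sculptable_def hda_embedding_def hda_morphism_def
  by (intro exI[of _ 0] exI[of _ "\<lambda>_. []"])
    (auto simp: cells_fan bulk_def star_positions_def hda_unfolding_def rooted_path_point inj_on_def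
      split: if_splits)

section \<open>The loop: neither it nor its unfolding is sculptable\<close>

abbreviation loop :: "nat hda" where "loop \<equiv> fan {1} (\<lambda>_. 0)"

text \<open>The faces of the only edge coincide, while those of its image in a bulk would
  differ.\<close>

lemma not_sculptable_loop: "\<not> sculptable loop"
proof
  assume "sculptable loop"
  then obtain d f where f: "hda_morphism f loop (bulk d)"
    by (auto simp: sculptable_def hda_embedding_def)
  have 1: "(1::nat) \<in> cells loop 1"
    by (simp add: cells_fan)
  have "f 1 \<in> cells (bulk d) 1" "face (bulk d) a 1 (f 1) = f (face loop a 1 1)" for a
    using f 1 unfolding hda_morphism_def by force+
  with bulk_edge_Src_neq_Tgt[of "f 1" d] show False
    by simp
qed

text \<open>Homotopy classes are singletons here, so each winding number gives a different vertex
  over \<open>0\<close>.\<close>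

lemma not_sculptable_unfolding_loop: "\<not> sculptable (hda_unfolding loop)"
proof
  assume "sculptable (hda_unfolding loop)"
  then have fin: "finite (all_cells (hda_unfolding loop))"
    by (rule sculptable_imp_finite)
  \<comment> \<open>One round consists of entering and leaving the edge, so \<open>\<pi> n\<close>
    has \<open>2 * n\<close> steps; the length shows injectivity below.\<close>
  define \<pi> :: "nat \<Rightarrow> nat path"
    where "\<pi> n = (0, concat (replicate n [(Src, 1, 1), (Tgt, 1, 0)]))" for n
  have steps: "are_steps loop 0 (snd (\<pi> n)) \<and> path_end (\<pi> n) = 0" for n
    by (induction n) (auto simp: \<pi>_def is_step_fan)
  then have "rooted_path loop (\<pi> n)" for n
    by (auto simp: rooted_path_def is_path_def all_cells_fan \<pi>_def)
  then have "(0, homotopy_class loop (\<pi> n)) \<in> cells (hda_unfolding loop) 0" for n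
    using steps unfolding hda_unfolding_def
    by (auto simp: cells_fan simp del: split_paired_Ex intro!: exI[of _ "\<pi> n"])
  then have "range (\<lambda>n. (0, {\<pi> n})) \<subseteq> all_cells (hda_unfolding loop)"
    by (force simp: homotopy_class_fan)
  with fin have "finite (range (\<lambda>n. (0::nat, {\<pi> n})))"
    using finite_subset by blast
  moreover have "inj (\<lambda>n. (0::nat, {\<pi> n}))"
  proof (rule injI)
    fix m n assume "(0::nat, {\<pi> m}) = (0, {\<pi> n})"
    then have "length (snd (\<pi> m)) = length (snd (\<pi> n))"
      by simp
    then show "m = n"
      by (simp add: \<pi>_def length_concat sum_list_replicate)
  qed
  ultimately show False
    using finite_imageD infinite_UNIV_nat by blast
qed

section \<open>The bubble: two parallel edges, separated by unfolding\<close>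

abbreviation bubble :: "nat hda" where "bubble \<equiv> fan {2, 3} (\<lambda>_. 4)"

lemma acyclic_bubble: "acyclic_hda bubble"
  \<comment> \<open>The start vertex has height 0, both edges have height 1, and the end vertex has
    height 2.\<close>
  by (rule acyclic_hda_height[of _ "\<lambda>q. if q = 0 then 0 else if q = 4 then 2 else 1"])
    (auto simp: is_step_fan split: side.splits if_splits)

lemma not_sculptable_bubble: "\<not> sculptable bubble"
proof
  assume "sculptable bubble"
  then obtain d f where f: "hda_morphism f bubble (bulk d)" and inj: "inj_on f (all_cells bubble)"
    by (auto simp: sculptable_def hda_embedding_def)
  have e: "e \<in> cells bubble 1" if "e \<in> {2, 3}" for e :: nat
    using that by (simp add: cells_fan)
  have *: "f e \<in> cells (bulk d) 1" "face (bulk d) a 1 (f e) = f (face bubble a 1 e)"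
    if "e \<in> {2, 3}" for a e
    using f e[OF that] unfolding hda_morphism_def by force+
  have "face (bulk d) a 1 (f 2) = face (bulk d) a 1 (f 3)" for a
    using *(2)[of 2 a] *(2)[of 3 a] by (cases a) simp_all
  then have "f 2 = f 3"
    using *(1) bulk_edge_determined_by_ends[of "f 2" d "f 3"] by simp
  with inj show False
    by (auto simp: inj_on_def all_cells_fan)
qed

lemma rooted_path_bubble:
  "rooted_path bubble \<pi> \<longleftrightarrow>
     \<pi> \<in> {(0, []), (0, [(Src, 1, 2)]), (0, [(Src, 1, 3)]),
          (0, [(Src, 1, 2), (Tgt, 1, 4)]), (0, [(Src, 1, 3), (Tgt, 1, 4)])}"
proof -
  \<comment> \<open>This splits off the first step. It is only used for fixed starts, going back
    from \<open>4\<close> to the edges and then to \<open>0\<close>, as it would rewrite its own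
    right-hand side.\<close>
  have steps_iff: "are_steps bubble p xs \<longleftrightarrow> xs = [] \<or>
      (\<exists>q ys. xs = (Src, 1, q) # ys \<and> p = 0 \<and> q \<in> {2, 3} \<and> are_steps bubble q ys) \<or>
      (\<exists>ys. xs = (Tgt, 1, 4) # ys \<and> p \<in> {2, 3} \<and> are_steps bubble 4 ys)" for p xs
  proof (cases xs)
    case (Cons x ys)
    obtain a i q where "x = (a, i, q)"
      by (cases x)
    with Cons show ?thesis
      by (cases a) (simp_all add: is_step_fan, blast+)
  qed simp
  have 1: "are_steps bubble 4 xs \<longleftrightarrow> xs = []" for xs
    by (subst steps_iff) simp
  have 2: "are_steps bubble e xs \<longleftrightarrow> xs = [] \<or> xs = [(Tgt, 1, 4)]" if "e \<in> {2, 3}" for xs e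
    unfolding steps_iff[of e xs] 1 using that by auto
  have "are_steps bubble 0 xs \<longleftrightarrow> xs = [] \<or> (\<exists>e ys. e \<in> {2, 3} \<and> xs = (Src, 1, e) # ys \<and>
      (ys = [] \<or> ys = [(Tgt, 1, 4)]))" for xs
    unfolding steps_iff[of 0 xs] by (auto simp del: are_steps.simps simp: 2)
  then show ?thesis
    by (cases \<pi>) (auto simp: rooted_path_def is_path_def all_cells_fan)
qed

lemma sculptable_unfolding_bubble: "sculptable (hda_unfolding bubble)"
proof -
  \<comment> \<open>The edges go to the two axes of the square. Only the vertex \<open>4\<close> has
    two copies, so only there is the class inspected.\<close>
  define f :: "nat \<times> nat path set \<Rightarrow> coord list" where
    "f = (\<lambda>(q, C). if q = 0 then [Zero, Zero] else if q = 2 then [Star, Zero]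
      else if q = 3 then [Zero, Star]
      else if C = {(0, [(Src, 1, 2), (Tgt, 1, 4)])} then [One, Zero] else [Zero, One])"
  have Src: "face (hda_unfolding bubble) Src 1 (e, {(0, [(Src, 1, e)])}) = (0, {(0, [])})"
    if "e \<in> {2, 3}" for e
  proof -
    have "homotopic bubble (0, []) \<rho>" if "rooted_path bubble \<rho>" "path_end \<rho> = 0" for \<rho>
      using that unfolding rooted_path_bubble by (auto simp: homotopic_refl)
    moreover have "rooted_path bubble (0, [])"
      by (simp add: rooted_path_bubble)
    ultimately show ?thesis
      using face_unfolding_Src[of bubble "(0, [])" 1 e]
      by (simp add: homotopy_class_fan path_snoc_def)
  qed
  have Tgt: "face (hda_unfolding bubble) Tgt 1 (e, {(0, [(Src, 1, e)])})
      = (4, {(0, [(Src, 1, e), (Tgt, 1, 4)])})"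
    if "e \<in> {2, 3}" for e
    using face_unfolding_Tgt[of "(0, [(Src, 1, e)])" bubble 1 1 4] that
    by (auto simp: homotopy_class_fan path_snoc_def cells_fan)
  have cells: "cells (hda_unfolding bubble) n =
    (if n = 0 then {(0, {(0, [])}), (4, {(0, [(Src, 1, 2), (Tgt, 1, 4)])}),
      (4, {(0, [(Src, 1, 3), (Tgt, 1, 4)])})}
     else if n = 1 then {(2, {(0, [(Src, 1, 2)])}), (3, {(0, [(Src, 1, 3)])})} else {})" for n
    by (auto simp: hda_unfolding_def homotopy_class_fan rooted_path_bubble cells_fan)
  have "init (hda_unfolding bubble) = (0, {(0, [])})"
    by (simp add: hda_unfolding_def homotopy_class_fan)
  moreover have "f (face (hda_unfolding bubble) a k q) = face (bulk 2) a k (f q)"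
    if "q \<in> cells (hda_unfolding bubble) n" "k \<in> {1..n}" for q n a k
  proof -
    have [simp]: "star_positions [Star, Zero] = [0]" "star_positions [Zero, Star] = [1]"
      by code_simp+
    from that have "k = 1" "q \<in> {(2, {(0, [(Src, 1, 2)])}), (3, {(0, [(Src, 1, 3)])})}"
      by (auto simp: cells split: if_splits)
    then show ?thesis
      using Src Tgt by (cases a) (auto simp: f_def bulk_def)
  qed
  moreover have "f q \<in> cells (bulk 2) n" if "q \<in> cells (hda_unfolding bubble) n" for q n
    using that by (auto simp: cells f_def bulk_def star_positions_def split: if_splits)
  moreover have "inj_on f (all_cells (hda_unfolding bubble))"
    by (auto simp: cells f_def inj_on_def split: if_splits)
  moreover have "f (0, {(0, [])}) = init (bulk 2)"
    by (simp add: f_def bulk_def numeral_2_eq_2)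
  ultimately show ?thesis
    unfolding sculptable_def hda_embedding_def hda_morphism_def
    by (intro exI[of _ 2] exI[of _ f]) simp
qed

section \<open>The open box\<close>

text \<open>
  The boundary of the cube without its bottom \<open>**0\<close>.  The cell \<open>x\<^sub>1x\<^sub>2x\<^sub>3\<close> is coded by the number
  with these decimal digits, where \<open>2\<close> stands for \<open>*\<close>; thus \<open>place_values q\<close> lists the place values
  of the stars of \<open>q\<close>.
\<close>

definition box_cells :: "nat list" where
  "box_cells = [0, 1, 10, 11, 100, 101, 110, 111,
     2, 12, 102, 112, 20, 21, 120, 121, 200, 201, 210, 211, 22, 122, 202, 212, 221]"

definition place_values :: "nat \<Rightarrow> nat list" where
  "place_values q = filter (\<lambda>p. q div p mod 10 = 2) [100, 10, 1]"

text \<open>As a star is the digit \<open>2\<close>, subtracting its place value twice leaves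
  \<open>0\<close>, and once leaves \<open>1\<close>. The place values descend, so the
  \<open>k\<close>-th entry belongs to the \<open>k\<close>-th star from the left.\<close>

fun box_face :: "side \<Rightarrow> nat \<Rightarrow> nat \<Rightarrow> nat" where
  "box_face Src k q = q - 2 * place_values q ! (k - 1)"
| "box_face Tgt k q = q - place_values q ! (k - 1)"

definition box :: "nat hda" where
  "box =
     \<lparr> cells = (\<lambda>n. {q \<in> set box_cells. length (place_values q) = n}),
       face = box_face,
       init = 0 \<rparr>"

lemma face_box [simp]: "face box = box_face"
  by (simp add: box_def)

lemma init_box [simp]: "init box = 0"
  by (simp add: box_def)

lemma all_cells_box: "all_cells box = set box_cells"
  by (auto simp: box_def)

lemma cells_box_iff: "q \<in> cells box n \<longleftrightarrow> q \<in> set box_cells \<and> length (place_values q) = n"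
  by (simp add: box_def)

text \<open>An explicit list of all steps, with their starts, over which the simplifier can
  enumerate.\<close>

definition box_steps :: "(nat \<times> side \<times> nat \<times> nat) list" where
  "box_steps = concat (map (\<lambda>q. concat (map (\<lambda>i.
     [(box_face Src i q, Src, i, q), (q, Tgt, i, box_face Tgt i q)])
     [1..<Suc (length (place_values q))])) box_cells)"

lemma is_step_box: "is_step box p (a, i, q) \<longleftrightarrow> (p, a, i, q) \<in> set box_steps"
  by (cases a) (auto simp: is_step.simps cells_box_iff box_steps_def)

text \<open>A table computed once and then used as simp rules in the checks over all cells.\<close>

lemma place_values_box_cells:
  "map place_values box_cells =
     [[], [], [], [], [], [], [], [], [1], [1], [1], [1],
      [10], [10], [10], [10], [100], [100], [100], [100],
      [10, 1], [10, 1], [100, 1], [100, 1], [100, 10]]"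
  by (simp add: box_cells_def place_values_def)

lemmas place_values_simps [simp] =
  place_values_box_cells[unfolded box_cells_def, simplified]

lemmas box_steps_simps = box_steps_def[unfolded box_cells_def, simplified]

lemma precubical_set_box: "precubical_set box"
proof
  \<comment> \<open>Index ranges are written as lists so that simplification turns the claim into
    finitely many equations.\<close>
  have "\<forall>q \<in> set box_cells. \<forall>k \<in> set [1..<Suc (length (place_values q))].
      box_face a k q \<in> set box_cells \<and>
      length (place_values (box_face a k q)) = length (place_values q) - 1" for a
    by (cases a) (simp_all add: box_cells_def)
  note * = this[rule_format]
  show "face box a k q \<in> cells box (n - 1)"
    if "q \<in> cells box n" "1 \<le> k" "k \<le> n" for q n k a
    using that *[of q k a] by (auto simp: cells_box_iff simp del: upt_Suc)
  have "\<forall>q \<in> set box_cells. \<forall>l \<in> set [1..<Suc (length (place_values q))]. \<forall>k \<in> set [1..<l].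
      box_face a k (box_face b l q) = box_face b (l - 1) (box_face a k q)" for a b
    by (cases a; cases b) (simp_all add: box_cells_def)
  note * = this[rule_format]
  show "face box a k (face box b l q) = face box b (l - 1) (face box a k q)"
    if "q \<in> cells box n" "1 \<le> k" "k < l" "l \<le> n" for q n k l a b
    using that *[of q l k a b] by (auto simp: cells_box_iff simp del: upt_Suc)
qed (auto simp: cells_box_iff)

text \<open>Decoding the digits gives the inclusion of the open box in the cube.\<close>

definition box_embedding :: "nat \<Rightarrow> coord list" where
  "box_embedding q = map (\<lambda>p. [Zero, One, Star] ! (q div p mod 10)) [100, 10, 1]"

lemma sculptable_box: "sculptable box"
proof -
  have "\<forall>q \<in> set box_cells. length (star_positions (box_embedding q)) = length (place_values q)"
    by (simp add: box_cells_def box_embedding_def star_positions_def)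
  then have 1: "box_embedding q \<in> cells (bulk 3) n" if "q \<in> cells box n" for q n
    using that by (auto simp: cells_box_iff bulk_def) (simp add: box_embedding_def)
  have *: "\<forall>q \<in> set box_cells. \<forall>k \<in> set [1..<Suc (length (place_values q))].
      box_embedding (box_face a k q) =
      (box_embedding q)[star_positions (box_embedding q) ! (k - 1) := side_coord a]" for a
    by (cases a) (simp_all add: box_cells_def box_embedding_def star_positions_def)
  have 2: "box_embedding (face box a k q) = face (bulk 3) a k (box_embedding q)"
    if "q \<in> cells box n" "k \<in> {1..n}" for q n k a
    using that *[rule_format, of q k a] by (auto simp: cells_box_iff bulk_def simp del: upt_Suc)
  have 3: "box_embedding (init box) = init (bulk 3)"
    by (simp add: box_embedding_def bulk_def numeral_3_eq_3)
  have "distinct (map box_embedding box_cells)"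
    by (simp add: box_cells_def box_embedding_def)
  then have 4: "inj_on box_embedding (all_cells box)"
    unfolding all_cells_box distinct_map by blast
  have "hda_embedding box_embedding box (bulk 3)"
    unfolding hda_embedding_def hda_morphism_def using 1 2 3 4 by blast
  then show ?thesis
    unfolding sculptable_def by blast
qed

section \<open>Enumeration of rooted paths in the open box\<close>

definition box_paths :: "nat \<Rightarrow> (side \<times> nat \<times> nat) list set" where
  "box_paths q = {xs. rooted_path box (0, xs) \<and> path_end (0, xs) = q}"

text \<open>The union runs over the explicit list of all steps, with an \<open>if\<close> selecting
  those into \<open>q\<close>, so that simplification evaluates it.\<close>

lemma box_paths_rec:
  "box_paths q = (if q = 0 then {[]} else {}) \<union>
     (\<Union>(p, a, i, q') \<in> set box_steps. if q' = q then (\<lambda>xs. xs @ [(a, i, q)]) ` box_paths p else {})"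
    (is "_ = _ \<union> \<Union> (?F ` _)")
proof -
  have "0 \<in> all_cells box"
    by (simp add: all_cells_box box_cells_def)
  then have *: "xs \<in> box_paths q \<longleftrightarrow> xs = [] \<and> q = 0 \<or>
      (\<exists>p a i ys. xs = ys @ [(a, i, q)] \<and> ys \<in> box_paths p \<and> (p, a, i, q) \<in> set box_steps)" for xs
    using rooted_path_iff_last_step[of box 0 xs q] unfolding box_paths_def is_step_box by auto
  have "box_paths q = (if q = 0 then {[]} else {}) \<union>
      {xs. \<exists>p a i. (p, a, i, q) \<in> set box_steps \<and> xs \<in> (\<lambda>xs. xs @ [(a, i, q)]) ` box_paths p}"
    by (rule set_eqI) (simp only: *, auto)
  also have "{xs. \<exists>p a i. (p, a, i, q) \<in> set box_steps \<and> xs \<in> (\<lambda>xs. xs @ [(a, i, q)]) ` box_paths p}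
      = \<Union> (?F ` set box_steps)" (is "?L = ?R")
  proof
    show "?L \<subseteq> ?R"
    proof
      fix xs assume "xs \<in> ?L"
      then obtain p a i where "(p, a, i, q) \<in> set box_steps" "xs \<in> ?F (p, a, i, q)"
        by auto
      then show "xs \<in> ?R" by (rule UN_I)
    qed
    show "?R \<subseteq> ?L"
      by (rule UN_least) (simp split: prod.splits, blast)
  qed
  finally show ?thesis .
qed

lemma box_paths_eval:
  "box_paths 0 = {[]}"
  "box_paths 200 = {[(Src, 1, 200)]}"
  "box_paths 20 = {[(Src, 1, 20)]}"
  "box_paths 2 = {[(Src, 1, 2)]}"
  "box_paths 100 = {[(Src, 1, 200), (Tgt, 1, 100)]}"
  "box_paths 10 = {[(Src, 1, 20), (Tgt, 1, 10)]}"
  "box_paths 202 = {[(Src, 1, 200), (Src, 2, 202)], [(Src, 1, 2), (Src, 1, 202)]}"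
  "box_paths 22 = {[(Src, 1, 20), (Src, 2, 22)], [(Src, 1, 2), (Src, 1, 22)]}"
  "box_paths 102 = {[(Src, 1, 200), (Src, 2, 202), (Tgt, 1, 102)],
    [(Src, 1, 2), (Src, 1, 202), (Tgt, 1, 102)], [(Src, 1, 200), (Tgt, 1, 100), (Src, 1, 102)]}"
  "box_paths 12 = {[(Src, 1, 20), (Src, 2, 22), (Tgt, 1, 12)],
    [(Src, 1, 2), (Src, 1, 22), (Tgt, 1, 12)], [(Src, 1, 20), (Tgt, 1, 10), (Src, 1, 12)]}"
proof -
  \<comment> \<open>The equation is recursive, so \<open>subst\<close> applies it once per cell;
    each group of cells relies on the previous one.\<close>
  note rec = box_paths_rec[unfolded box_steps_simps, simplified]
  show 0: "box_paths 0 = {[]}"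
    by (subst rec) simp
  show 1: "box_paths 200 = {[(Src, 1, 200)]}" "box_paths 20 = {[(Src, 1, 20)]}"
      "box_paths 2 = {[(Src, 1, 2)]}"
    by (subst rec, simp add: 0 numeral_2_eq_2)+
  show 2: "box_paths 100 = {[(Src, 1, 200), (Tgt, 1, 100)]}"
      "box_paths 10 = {[(Src, 1, 20), (Tgt, 1, 10)]}"
      "box_paths 202 = {[(Src, 1, 200), (Src, 2, 202)], [(Src, 1, 2), (Src, 1, 202)]}"
      "box_paths 22 = {[(Src, 1, 20), (Src, 2, 22)], [(Src, 1, 2), (Src, 1, 22)]}"
    by (subst rec, simp add: 1 numeral_2_eq_2)+
  show "box_paths 102 = {[(Src, 1, 200), (Src, 2, 202), (Tgt, 1, 102)],
    [(Src, 1, 2), (Src, 1, 202), (Tgt, 1, 102)], [(Src, 1, 200), (Tgt, 1, 100), (Src, 1, 102)]}"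
      "box_paths 12 = {[(Src, 1, 20), (Src, 2, 22), (Tgt, 1, 12)],
    [(Src, 1, 2), (Src, 1, 22), (Tgt, 1, 12)], [(Src, 1, 20), (Tgt, 1, 10), (Src, 1, 12)]}"
    by (subst rec, simp add: 2 numeral_2_eq_2)+
qed

lemma finite_hd_automaton_box: "finite_hd_automaton box"
proof -
  have "box_paths p \<noteq> {} \<Longrightarrow> box_paths q \<noteq> {}" if "(p, a, i, q) \<in> set box_steps" for p a i q
    using that by (subst box_paths_rec[of q]) fastforce
  \<comment> \<open>Each step becomes an implication between reachability of its ends; starting from
    \<open>0\<close>, simplification propagates this to all cells.\<close>
  then have "list_all (\<lambda>(p, a, i, q). box_paths p \<noteq> {} \<longrightarrow> box_paths q \<noteq> {}) box_steps"
    unfolding list_all_iff by blast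
  then have "\<forall>q \<in> set box_cells. box_paths q \<noteq> {}"
    using box_paths_eval(1) by (simp add: box_steps_simps box_cells_def)
  moreover have "finite (all_cells box)"
    by (simp add: all_cells_box)
  moreover have "init box \<in> cells box 0"
    by (simp add: cells_box_iff box_cells_def)
  moreover have "q \<in> set box_cells" if "q \<in> cells box n" for q n
    using that by (simp add: cells_box_iff)
  ultimately show ?thesis
    using precubical_set_box
    unfolding finite_hd_automaton_def finite_hd_automaton_axioms_def hd_automaton_def
      hd_automaton_axioms_def all_cells_box box_paths_def
    by blast
qed

text \<open>The four homotopy rules for \<open>i = 1\<close> and \<open>j = 2\<close>, the only
  indices possible in dimension 2.\<close>

inductive square_move ::
    "(side \<times> nat \<times> 'a) list \<Rightarrow> (side \<times> nat \<times> 'a) list \<Rightarrow> bool" where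
  "square_move [(Src, 1, q), (Src, 2, r)] [(Src, 1, q'), (Src, 1, r)]"
| "square_move [(Tgt, 2, q), (Tgt, 1, r)] [(Tgt, 1, q'), (Tgt, 1, r)]"
| "square_move [(Src, 1, q), (Tgt, 2, r)] [(Tgt, 1, q'), (Src, 1, r)]"
| "square_move [(Src, 2, q), (Tgt, 1, r)] [(Tgt, 1, q'), (Src, 1, r)]"

lemma elem_homotopic_square:
  assumes "square_move us vs" "is_path Q (p, xs @ us @ ys)" "is_path Q (p, xs @ vs @ ys)"
  shows "elem_homotopic Q (p, xs @ us @ ys) (p, xs @ vs @ ys)"
  using assms elem_homotopic.intros[where Q = Q and i = 1 and j = 2 and p = p and xs = xs and ys = ys]
  by (cases rule: square_move.cases) simp_all

text \<open>Reduces a move between explicit paths to naming the position \<open>n\<close> of the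
  exchanged segment; either orientation is accepted.\<close>

lemma homotopic_square:
  assumes "is_path Q (p, xs)" "is_path Q (p, ys)"
    and "take n xs = take n ys" "drop (n + 2) xs = drop (n + 2) ys"
    and "square_move (take 2 (drop n xs)) (take 2 (drop n ys)) \<or>
         square_move (take 2 (drop n ys)) (take 2 (drop n xs))"
  shows "homotopic Q (p, xs) (p, ys)"
proof -
  have split: "zs = take n zs @ take 2 (drop n zs) @ drop (n + 2) zs" for zs :: "(side \<times> nat \<times> 'a) list"
    by (metis append_take_drop_id drop_drop add.commute)
  show ?thesis
    using assms elem_homotopic_square[of _ _ Q p "take n xs" "drop (n + 2) xs"] split[of xs] split[of ys]
    by (metis elem_homotopic_imp_homotopic)
qed

lemma box_path_iff:
  "is_path box (p, xs) \<longleftrightarrow> p \<in> set box_cells \<and> are_steps box p xs"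
  by (simp add: is_path_def all_cells_box)

lemmas box_path_simps = box_path_iff is_step_box box_steps_simps

text \<open>All rooted paths to \<open>10*\<close> run inside the square \<open>*0*\<close>. This
  gives the uniqueness required for the source face of \<open>1**\<close> in the unfolding.\<close>

lemma homotopic_box_paths_102:
  assumes "xs \<in> box_paths 102"
  shows "homotopic box (0, [(Src, 1, 2), (Src, 1, 202), (Tgt, 1, 102)]) (0, xs)"
proof -
  have 1: "homotopic box (0, [(Src, 1, 2), (Src, 1, 202), (Tgt, 1, 102)])
      (0, [(Src, 1, 200), (Src, 2, 202), (Tgt, 1, 102)])"
    by (rule homotopic_square[where n = 0])
      (simp_all add: box_path_simps square_move.simps box_cells_def)
  have 2: "homotopic box (0, [(Src, 1, 200), (Src, 2, 202), (Tgt, 1, 102)])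
      (0, [(Src, 1, 200), (Tgt, 1, 100), (Src, 1, 102)])"
    by (rule homotopic_square[where n = 1])
      (simp_all add: box_path_simps square_move.simps box_cells_def)
  show ?thesis
    using assms 1 homotopic_trans[OF 1 2] unfolding box_paths_eval
    by (auto simp: homotopic_refl)
qed

text \<open>The mirror image, with the first two coordinates exchanged: paths to \<open>01*\<close>
  run inside \<open>0**\<close>.\<close>

lemma homotopic_box_paths_12:
  assumes "xs \<in> box_paths 12"
  shows "homotopic box (0, [(Src, 1, 2), (Src, 1, 22), (Tgt, 1, 12)]) (0, xs)"
proof -
  have 1: "homotopic box (0, [(Src, 1, 2), (Src, 1, 22), (Tgt, 1, 12)])
      (0, [(Src, 1, 20), (Src, 2, 22), (Tgt, 1, 12)])"
    by (rule homotopic_square[where n = 0])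
      (simp_all add: box_path_simps square_move.simps box_cells_def)
  have 2: "homotopic box (0, [(Src, 1, 20), (Src, 2, 22), (Tgt, 1, 12)])
      (0, [(Src, 1, 20), (Tgt, 1, 10), (Src, 1, 12)])"
    by (rule homotopic_square[where n = 1])
      (simp_all add: box_path_simps square_move.simps box_cells_def)
  show ?thesis
    using assms 1 homotopic_trans[OF 1 2] unfolding box_paths_eval
    by (auto simp: homotopic_refl)
qed

text \<open>The path is pushed through \<open>1**\<close> and \<open>*0*\<close> up to the top
  \<open>**1\<close>, across it, and down again through \<open>0**\<close> and
  \<open>*1*\<close>.\<close>

lemma homotopic_around_box:
  "homotopic box
     (0, [(Src, 1, 2), (Src, 1, 202), (Tgt, 1, 102), (Src, 1, 122), (Tgt, 1, 112), (Tgt, 1, 111)])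
     (0, [(Src, 1, 2), (Src, 1, 22), (Tgt, 1, 12), (Src, 1, 212), (Tgt, 1, 112), (Tgt, 1, 111)])"
    (is "homotopic _ _ ?last")
proof -
  note square_simps = box_path_simps square_move.simps box_cells_def
  have "homotopic box
     (0, [(Src, 1, 2), (Src, 1, 202), (Tgt, 1, 102), (Src, 1, 122), (Tgt, 1, 112), (Tgt, 1, 111)])
     (0, [(Src, 1, 2), (Src, 1, 202), (Tgt, 1, 102), (Src, 1, 122), (Tgt, 2, 121), (Tgt, 1, 111)])"
    by (rule homotopic_square[where n = 4]) (simp_all add: square_simps)
  also have "homotopic box \<dots>
     (0, [(Src, 1, 2), (Src, 1, 202), (Tgt, 1, 102), (Tgt, 1, 101), (Src, 1, 121), (Tgt, 1, 111)])"
    by (rule homotopic_square[where n = 3]) (simp_all add: square_simps)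
  also have "homotopic box \<dots>
     (0, [(Src, 1, 2), (Src, 1, 202), (Tgt, 2, 201), (Tgt, 1, 101), (Src, 1, 121), (Tgt, 1, 111)])"
    by (rule homotopic_square[where n = 2]) (simp_all add: square_simps)
  also have "homotopic box \<dots>
     (0, [(Src, 1, 2), (Tgt, 1, 1), (Src, 1, 201), (Tgt, 1, 101), (Src, 1, 121), (Tgt, 1, 111)])"
    by (rule homotopic_square[where n = 1]) (simp_all add: square_simps)
  \<comment> \<open>These four moves cross the top; the remaining ones reverse the first four with
    the first two coordinates exchanged.\<close>
  also have "homotopic box \<dots>
     (0, [(Src, 1, 2), (Tgt, 1, 1), (Src, 1, 201), (Src, 2, 221), (Tgt, 1, 121), (Tgt, 1, 111)])"
    by (rule homotopic_square[where n = 3]) (simp_all add: square_simps)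
  also have "homotopic box \<dots>
     (0, [(Src, 1, 2), (Tgt, 1, 1), (Src, 1, 21), (Src, 1, 221), (Tgt, 1, 121), (Tgt, 1, 111)])"
    by (rule homotopic_square[where n = 2]) (simp_all add: square_simps)
  also have "homotopic box \<dots>
     (0, [(Src, 1, 2), (Tgt, 1, 1), (Src, 1, 21), (Src, 1, 221), (Tgt, 2, 211), (Tgt, 1, 111)])"
    by (rule homotopic_square[where n = 4]) (simp_all add: square_simps)
  also have "homotopic box \<dots>
     (0, [(Src, 1, 2), (Tgt, 1, 1), (Src, 1, 21), (Tgt, 1, 11), (Src, 1, 211), (Tgt, 1, 111)])"
    by (rule homotopic_square[where n = 3]) (simp_all add: square_simps)
  also have "homotopic box \<dots>
     (0, [(Src, 1, 2), (Src, 1, 22), (Tgt, 2, 21), (Tgt, 1, 11), (Src, 1, 211), (Tgt, 1, 111)])"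
    by (rule homotopic_square[where n = 1]) (simp_all add: square_simps)
  also have "homotopic box \<dots>
     (0, [(Src, 1, 2), (Src, 1, 22), (Tgt, 1, 12), (Tgt, 1, 11), (Src, 1, 211), (Tgt, 1, 111)])"
    by (rule homotopic_square[where n = 2]) (simp_all add: square_simps)
  also have "homotopic box \<dots>
     (0, [(Src, 1, 2), (Src, 1, 22), (Tgt, 1, 12), (Src, 1, 212), (Tgt, 2, 211), (Tgt, 1, 111)])"
    by (rule homotopic_square[where n = 3]) (simp_all add: square_simps)
  also have "homotopic box \<dots> ?last"
    by (rule homotopic_square[where n = 4]) (simp_all add: square_simps)
  finally show ?thesis .
qed

text \<open>
  The two sides of the missing bottom cannot be mixed: a rooted path to \<open>11*\<close> that turns towards
  \<open>x\<^sub>1 = 1\<close> first differs from one that turns towards \<open>x\<^sub>2 = 1\<close> first both in its second and in its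
  third step, whereas an elementary homotopy changes only one cell.
\<close>

lemma box_paths_112:
  assumes "xs \<in> box_paths 112"
  shows "map (snd \<circ> snd) xs ! 1 \<in> {100, 202} \<and> map (snd \<circ> snd) xs ! 2 \<in> {120, 102} \<or>
         map (snd \<circ> snd) xs ! 1 \<in> {10, 22} \<and> map (snd \<circ> snd) xs ! 2 \<in> {210, 12}"
proof -
  note rec = box_paths_rec[unfolded box_steps_simps, simplified]
  have 1: "box_paths 120 = {[(Src, 1, 200), (Tgt, 1, 100), (Src, 1, 120)]}"
      "box_paths 210 = {[(Src, 1, 20), (Tgt, 1, 10), (Src, 1, 210)]}"
    by (subst rec, simp add: box_paths_eval)+
  have 2: "box_paths 110 = (\<lambda>xs. xs @ [(Tgt, 1, 110)]) ` (box_paths 120 \<union> box_paths 210)"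
    by (subst rec) (simp add: image_Un)
  have 3: "box_paths 122 = (\<lambda>xs. xs @ [(Src, 1, 122)]) ` box_paths 102 \<union>
        (\<lambda>xs. xs @ [(Src, 2, 122)]) ` box_paths 120"
      "box_paths 212 = (\<lambda>xs. xs @ [(Src, 1, 212)]) ` box_paths 12 \<union>
        (\<lambda>xs. xs @ [(Src, 2, 212)]) ` box_paths 210"
    by (subst rec, simp add: numeral_2_eq_2)+
  have 4: "box_paths 112 = (\<lambda>xs. xs @ [(Src, 1, 112)]) ` box_paths 110 \<union>
      (\<lambda>xs. xs @ [(Tgt, 1, 112)]) ` (box_paths 122 \<union> box_paths 212)"
    by (subst rec) (simp add: image_Un)
  have "\<forall>xs \<in> box_paths 112.
      map (snd \<circ> snd) xs ! 1 \<in> {100, 202} \<and> map (snd \<circ> snd) xs ! 2 \<in> {120, 102} \<or>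
      map (snd \<circ> snd) xs ! 1 \<in> {10, 22} \<and> map (snd \<circ> snd) xs ! 2 \<in> {210, 12}"
    unfolding 4 2 3 1 box_paths_eval by simp
  with assms show ?thesis by blast
qed

lemma not_homotopic_112:
  "\<not> homotopic box
     (0, [(Src, 1, 2), (Src, 1, 202), (Tgt, 1, 102), (Src, 1, 122), (Tgt, 1, 112)])
     (0, [(Src, 1, 2), (Src, 1, 22), (Tgt, 1, 12), (Src, 1, 212), (Tgt, 1, 112)])"
    (is "\<not> homotopic _ ?\<pi> ?\<rho>")
proof
  \<comment> \<open>Membership in \<open>box_paths 112\<close> belongs to the invariant so that the
    dichotomy \<open>box_paths_112\<close> applies to each next path.\<close>
  let ?P = "\<lambda>\<pi>. fst \<pi> = 0 \<and> snd \<pi> \<in> box_paths 112 \<and>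
    map (snd \<circ> snd) (snd \<pi>) ! 1 \<in> {100, 202} \<and> map (snd \<circ> snd) (snd \<pi>) ! 2 \<in> {120, 102}"
  assume "homotopic box ?\<pi> ?\<rho>"
  then have "?P ?\<rho>"
  proof (rule homotopic_invariant)
    show "?P ?\<pi>"
      by (simp add: box_paths_def rooted_path_def box_path_simps box_cells_def)
  next
    fix \<sigma> \<tau> :: "nat path"
    assume P: "?P \<sigma>" and elem: "elem_homotopic box \<sigma> \<tau> \<or> elem_homotopic box \<tau> \<sigma>"
    then have "fst \<tau> = 0" "is_path box \<tau>" "path_end \<tau> = path_end \<sigma>"
      using elem_homotopic_is_path elem_homotopic_endpoints by metis+
    with P have \<tau>: "fst \<tau> = 0" "snd \<tau> \<in> box_paths 112"
      by (cases \<sigma>; cases \<tau>; simp add: box_paths_def rooted_path_def)+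
    obtain m where
      "\<And>k. k \<noteq> m \<Longrightarrow> map (snd \<circ> snd) (snd \<sigma>) ! k = map (snd \<circ> snd) (snd \<tau>) ! k"
      using elem by (metis elem_homotopic_differs_once)
    then have "map (snd \<circ> snd) (snd \<sigma>) ! 1 = map (snd \<circ> snd) (snd \<tau>) ! 1 \<or>
        map (snd \<circ> snd) (snd \<sigma>) ! 2 = map (snd \<circ> snd) (snd \<tau>) ! 2"
      by (cases "m = 1") auto
    then show "?P \<tau>"
      using P \<tau> box_paths_112[OF \<tau>(2)] by auto
  qed
  then show False by simp
qed

lemma not_sculptable_unfolding_box: "\<not> sculptable (hda_unfolding box)"
proof
  assume "sculptable (hda_unfolding box)"
  then obtain d f where f: "hda_morphism f (hda_unfolding box) (bulk d)"
      and inj: "inj_on f (all_cells (hda_unfolding box))"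
    by (auto simp: sculptable_def hda_embedding_def)
  define c where "c xs = (path_end (0, xs), homotopy_class box (0, xs))" for xs
  have cell: "c xs \<in> cells (hda_unfolding box) n" if "xs \<in> box_paths q" "q \<in> cells box n" for xs q n
    using that unfolding c_def box_paths_def hda_unfolding_def by auto
  have face: "f (face (hda_unfolding box) a 1 (c xs)) = face (bulk d) a 1 (f (c xs))"
      and f_cell: "f (c xs) \<in> cells (bulk d) n"
    if "xs \<in> box_paths q" "q \<in> cells box n" "1 \<le> n" for a xs q n
    using f cell[OF that(1,2)] that(3) unfolding hda_morphism_def by auto
  have Tgt: "face (hda_unfolding box) Tgt 1 (c xs) = c (xs @ [(Tgt, 1, q')])"
    if xs: "xs \<in> box_paths q" and step: "(q, Tgt, 1, q') \<in> set box_steps" for xs q q'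
  proof -
    obtain n where "q \<in> cells box n" "1 \<le> n" "face box Tgt 1 q = q'"
      using step unfolding is_step_box[symmetric] is_step.simps by auto
    then show ?thesis
      using xs face_unfolding_Tgt[of "(0, xs)" box n 1 q']
      by (simp add: c_def box_paths_def path_snoc_def)
  qed
  \<comment> \<open>Crossing a square from a source face to the opposite target face preserves the
    direction of the image. Here \<open>unique\<close> ensures that the source face in the unfolding
    is the given copy of \<open>p\<close>.\<close>
  have parallel: "star_positions (f (c xs)) =
      star_positions (f (c (xs @ [(Src, 1, q), (Tgt, 1, q')])))"
    if xs: "xs \<in> box_paths p" and steps: "(p, Src, 1, q) \<in> set box_steps" "(q, Tgt, 1, q') \<in> set box_steps"
      and square: "q \<in> cells box 2"
      and unique: "\<And>ys. ys \<in> box_paths p \<Longrightarrow> homotopic box (0, xs) (0, ys)" for xs p q q'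
  proof -
    have xs': "xs @ [(Src, 1, q)] \<in> box_paths q"
      using xs steps(1) rooted_path_snoc[of box "(0, xs)" "(Src, 1, q)"]
      by (simp add: box_paths_def is_step_box path_snoc_def)
    have "face box Src 1 q = p"
      using steps(1) unfolding is_step_box[symmetric] is_step.simps by blast
    moreover have "homotopic box (0, xs) \<rho>" if "rooted_path box \<rho>" "path_end \<rho> = path_end (0, xs)" for \<rho>
      using unique[of "snd \<rho>"] that xs by (cases \<rho>) (auto simp: box_paths_def rooted_path_def)
    ultimately have Src: "face (hda_unfolding box) Src 1 (c (xs @ [(Src, 1, q)])) = c xs"
      using xs face_unfolding_Src[of box "(0, xs)" 1 q]
      by (simp add: c_def box_paths_def path_snoc_def)
    then show ?thesis
      using bulk_square_star_positions[OF f_cell[OF xs' square one_le_numeral]]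
      unfolding face[OF xs' square one_le_numeral, symmetric] Src Tgt[OF xs' steps(2)]
      by simp
  qed
  \<comment> \<open>The two copies of \<open>11*\<close>, reached by way of \<open>10*\<close> and
    of \<open>01*\<close>.\<close>
  let ?x = "[(Src, 1, 2), (Src, 1, 202), (Tgt, 1, 102), (Src, 1, 122), (Tgt, 1, 112)]"
  let ?y = "[(Src, 1, 2), (Src, 1, 22), (Tgt, 1, 12), (Src, 1, 212), (Tgt, 1, 112)]"
  have squares: "{202, 22, 122, 212} \<subseteq> cells box 2"
    by (simp add: cells_box_iff box_cells_def)
  \<comment> \<open>Both copies inherit the direction of \<open>00*\<close>, through
    \<open>*0*\<close> and \<open>1**\<close> or through \<open>0**\<close> and
    \<open>*1*\<close>.\<close>
  have "star_positions (f (c [(Src, 1, 2)])) = star_positions (f (c [(Src, 1, 2), (Src, 1, 202), (Tgt, 1, 102)]))"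
    using parallel[of "[(Src, 1, 2)]" 2 202 102] squares
    by (simp add: box_paths_eval box_steps_simps homotopic_refl)
  moreover have "star_positions (f (c [(Src, 1, 2), (Src, 1, 202), (Tgt, 1, 102)])) = star_positions (f (c ?x))"
    using parallel[of "[(Src, 1, 2), (Src, 1, 202), (Tgt, 1, 102)]" 102 122 112] squares
      homotopic_box_paths_102
    by (simp add: box_paths_eval box_steps_simps)
  moreover have "star_positions (f (c [(Src, 1, 2)])) = star_positions (f (c [(Src, 1, 2), (Src, 1, 22), (Tgt, 1, 12)]))"
    using parallel[of "[(Src, 1, 2)]" 2 22 12] squares
    by (simp add: box_paths_eval box_steps_simps homotopic_refl)
  moreover have "star_positions (f (c [(Src, 1, 2), (Src, 1, 22), (Tgt, 1, 12)])) = star_positions (f (c ?y))"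
    using parallel[of "[(Src, 1, 2), (Src, 1, 22), (Tgt, 1, 12)]" 12 212 112] squares
      homotopic_box_paths_12
    by (simp add: box_paths_eval box_steps_simps)
  ultimately have stars: "star_positions (f (c ?x)) = star_positions (f (c ?y))"
    by simp
  have edge: "112 \<in> cells box 1"
    by (simp add: cells_box_iff box_cells_def)
  have paths: "?x \<in> box_paths 112" "?y \<in> box_paths 112"
    by (simp_all add: box_paths_def rooted_path_def box_path_simps box_cells_def)
  \<comment> \<open>The homotopy over the top makes their targets equal, so direction and target
    force equal images.\<close>
  have "c (?x @ [(Tgt, 1, 111)]) = c (?y @ [(Tgt, 1, 111)])"
    using homotopic_around_box by (simp add: c_def homotopy_class_eq_iff)
  moreover have "(112, Tgt, 1, 111) \<in> set box_steps"
    by (simp add: box_steps_simps)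
  ultimately have "face (bulk d) Tgt 1 (f (c ?x)) = face (bulk d) Tgt 1 (f (c ?y))"
    using face[OF paths(1) edge order_refl] face[OF paths(2) edge order_refl] Tgt[OF paths(1)]
      Tgt[OF paths(2)] by metis
  then have "f (c ?x) = f (c ?y)"
    using bulk_edge_eqI stars f_cell[OF paths(1) edge order_refl]
      f_cell[OF paths(2) edge order_refl] by blast
  then have "c ?x = c ?y"
    using inj cell[OF paths(1) edge] cell[OF paths(2) edge] by (meson UN_I UNIV_I inj_onD)
  then show False
    using not_homotopic_112 by (simp add: c_def homotopy_class_eq_iff)
qed

theorem theorem6p1:
  shows "(\<exists>Q :: nat hda. finite_hd_automaton Q \<and> acyclic_hda Q \<and> \<not> sculptable Q) \<and>
    (\<exists>Q :: nat hda. finite_hd_automaton Q \<and> \<not> sculptable Q \<and> sculptable (hda_unfolding Q)) \<and>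
    (\<exists>Q :: nat hda. finite_hd_automaton Q \<and> sculptable Q \<and> \<not> sculptable (hda_unfolding Q)) \<and>
    (\<exists>Q :: nat hda. finite_hd_automaton Q \<and> sculptable Q \<and> sculptable (hda_unfolding Q)) \<and>
    (\<exists>Q :: nat hda. finite_hd_automaton Q \<and> \<not> sculptable Q \<and> \<not> sculptable (hda_unfolding Q))"
proof -
  have "finite_hd_automaton bubble" "finite_hd_automaton point" "finite_hd_automaton loop"
    by (rule finite_hd_automaton_fan; simp)+
  \<comment> \<open>The witnesses are, in order, \<open>bubble\<close>, \<open>bubble\<close>,
    \<open>box\<close>, \<open>point\<close> and \<open>loop\<close>.\<close>
  then show ?thesis
    using acyclic_bubble not_sculptable_bubble sculptable_unfolding_bubble
      finite_hd_automaton_box sculptable_box not_sculptable_unfolding_box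
      sculptable_point sculptable_unfolding_point
      not_sculptable_loop not_sculptable_unfolding_loop
    by blast
qed

end
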